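(* Let $\Omega=\{1,2,\dots,d\}^{\mathbb{N}}$, let $J_0,\tilde J_1$ be Hölder Jacobians on $\Omega$ with $\tilde J_1\neq J_0$, let $J_1$ be a Hölder Jacobian with equilibrium probability $\mu_1=\mu_{J_1}$, and for $\lambda\in[0,1]$ let $\mathfrak{J}_\lambda=\lambda\tilde J_1+(1-\lambda)J_0$, with equilibrium probability $\mu_{\mathfrak{J}_\lambda}$. Then $$\frac{d}{d\lambda}D_{KL}(\mu_1,\mu_{\mathfrak{J}_\lambda})\Big|_{\lambda=0}=\int\Big(1-\frac{\tilde J_1}{J_0}\Big)\,d\mu_1.$$
   Context: A Hölder Jacobian is a positive Hölder function $J:\Omega\to(0,1)$ such that $\mathscr{L}_{\log J}(1)=1$, where $\mathscr{L}_{\log J}f(x)=\sum_{\sigma(y)=x}J(y)f(y)$ is the Ruelle operator for $\log J$ and $\sigma$ is the shift on $\Omega$. To each Hölder Jacobian $J$ corresponds a unique shift-invariant probability $\mu_J$ (the equilibrium probability for $\log J$) with $\mathscr{L}_{\log J}^*(\mu_J)=\mu_J$. A convex combination of Hölder Jacobians is again a Hölder Jacobian. For Hölder Jacobians $J,J'$ the Kullback-Leibler divergence is $D_{KL}(\mu_J,\mu_{J'})=\int(\log J-\log J')\,d\mu_J\ge 0$. The derivative at $\lambda=0$ is that of a function of $\lambda\in[0,1]$. *)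

theory Defs
  imports "HOL-Probability.Probability"
begin

text \<open>
  The alphabet is a finite type \<open>'a\<close> whose cardinality plays the role of \<open>d\<close>, so that
  \<open>nat \<Rightarrow> 'a\<close> is the one-sided full shift. A type with a single element admits no
  Jacobian in the sense below.
\<close>

definition shift :: "(nat \<Rightarrow> 'a) \<Rightarrow> nat \<Rightarrow> 'a" where
  "shift x = (\<lambda>n. x (Suc n))"

definition shift_topology :: "(nat \<Rightarrow> 'a) topology" where
  "shift_topology = product_topology (\<lambda>_. discrete_topology UNIV) UNIV"

text \<open>As the alphabet is finite, this product is the Borel \<open>\<sigma>\<close>-algebra of the topology above.\<close>

definition shift_space :: "(nat \<Rightarrow> 'a) measure" where
  "shift_space = PiM UNIV (\<lambda>_. count_space UNIV)"

text \<open>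
  Replacing the base \<open>1/2\<close> by another one in \<open>(0,1)\<close> only changes Hoelder exponents, and
  a function that is Hoelder with some exponent above 1 is also Hoelder with exponent 1 because
  the metric is bounded. The class of Hoelder functions therefore does not depend on these choices.
\<close>

definition shift_dist :: "(nat \<Rightarrow> 'a) \<Rightarrow> (nat \<Rightarrow> 'a) \<Rightarrow> real" where
  "shift_dist x y = (if x = y then 0 else (1 / 2) ^ (LEAST n. x n \<noteq> y n))"

definition holder :: "((nat \<Rightarrow> 'a) \<Rightarrow> real) \<Rightarrow> bool" where
  "holder f \<longleftrightarrow> (\<exists>C \<alpha>. 0 < \<alpha> \<and> \<alpha> \<le> 1 \<and>
     (\<forall>x y. \<bar>f x - f y\<bar> \<le> C * shift_dist x y powr \<alpha>))"

definition ruelle ::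
  "((nat \<Rightarrow> 'a::finite) \<Rightarrow> real) \<Rightarrow> ((nat \<Rightarrow> 'a) \<Rightarrow> real) \<Rightarrow> (nat \<Rightarrow> 'a) \<Rightarrow> real" where
  "ruelle \<phi> f x = (\<Sum>y | shift y = x. exp (\<phi> y) * f y)"

definition holder_jacobian :: "((nat \<Rightarrow> 'a::finite) \<Rightarrow> real) \<Rightarrow> bool" where
  "holder_jacobian J \<longleftrightarrow> (\<forall>x. 0 < J x \<and> J x < 1) \<and> holder J \<and>
     ruelle (\<lambda>x. ln (J x)) (\<lambda>_. 1) = (\<lambda>_. 1)"

text \<open>The last conjunct is the fixed-point equation for the dual Ruelle operator.\<close>

definition equilibrium_prob ::
  "((nat \<Rightarrow> 'a::finite) \<Rightarrow> real) \<Rightarrow> (nat \<Rightarrow> 'a) measure \<Rightarrow> bool" where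
  "equilibrium_prob J \<mu> \<longleftrightarrow>
     prob_space \<mu> \<and> sets \<mu> = sets shift_space \<and> distr \<mu> \<mu> shift = \<mu> \<and>
     (\<forall>f. continuous_map shift_topology euclideanreal f \<longrightarrow>
        (LINT x|\<mu>. ruelle (\<lambda>y. ln (J y)) f x) = (LINT x|\<mu>. f x))"

text \<open>
  An equilibrium probability determines its Hoelder Jacobian: it gives positive mass to every
  cylinder, and the fixed-point equation applied to \<open>J - J'\<close> times the indicator of the
  cylinder of a letter forces two Jacobians of the same measure to agree almost everywhere, hence
  everywhere by continuity. Thus the following description is definite on the measures of
  interest, and the divergence is a function of the two measures.
\<close>

definition jacobian_of :: "(nat \<Rightarrow> 'a::finite) measure \<Rightarrow> (nat \<Rightarrow> 'a) \<Rightarrow> real" where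
  "jacobian_of \<mu> = (THE J. holder_jacobian J \<and> equilibrium_prob J \<mu>)"

definition D_KL :: "(nat \<Rightarrow> 'a::finite) measure \<Rightarrow> (nat \<Rightarrow> 'a) measure \<Rightarrow> real" where
  "D_KL \<mu> \<nu> = (LINT x|\<mu>. ln (jacobian_of \<mu> x) - ln (jacobian_of \<nu> x))"

end

theory Submission
  imports Defs
begin

text \<open>
  The divergence is defined through the Jacobian of a measure, and it can be computed because an
  equilibrium probability has only one Hoelder Jacobian. If \<open>J\<close> and \<open>J'\<close> both serve \<open>\<mu>\<close>, the two
  fixed-point equations tested on \<open>J - J'\<close> differ by the integral of
  \<open>\<Sum>a. (J (a x) - J' (a x))\<^sup>2\<close>, which therefore vanishes. The measure \<open>\<mu>\<close> charges every cylinder: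
  by the fixed-point equation, the mass of the cylinder \<open>a w\<close> is the integral of the positive
  function \<open>J (a x)\<close> over the cylinder \<open>w\<close>. A continuous nonnegative function with integral zero
  is thus identically zero, and \<open>J = J'\<close> (\<open>equilibrium_prob_jacobian_unique\<close>).

  Since convex combinations of Jacobians are Jacobians, the divergence at parameter \<open>l\<close> is then
  \<open>\<integral> ln J1 - ln (J0 + l (J1' - J0)) d\<mu>1\<close>. With \<open>h = J1' / J0 - 1\<close> the increment from \<open>0\<close> to \<open>l\<close>
  is \<open>- \<integral> ln (1 + l h) d\<mu>1\<close>. The shift space is compact and \<open>h\<close> is continuous, so \<open>h\<close> is bounded, and
  \<open>ln (1 + u) = u + O(u\<^sup>2)\<close> holds uniformly along \<open>u = l h x\<close>; this gives the derivative \<open>- \<integral> h d\<mu>1\<close>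
  at \<open>l = 0\<close>.
\<close>

section \<open>Cylinders and the topology of the shift space\<close>

definition cylinder :: "nat \<Rightarrow> (nat \<Rightarrow> 'a) \<Rightarrow> (nat \<Rightarrow> 'a) set" where
  "cylinder n x = {y. \<forall>i<n. y i = x i}"

lemma topspace_shift_topology [simp]: "topspace shift_topology = UNIV"
  by (simp add: shift_topology_def)

lemma space_shift_space [simp]: "space shift_space = UNIV"
  by (simp add: shift_space_def space_PiM)

lemma openin_shift_topology_iff:
  "openin shift_topology S \<longleftrightarrow> (\<forall>x\<in>S. \<exists>n. cylinder n x \<subseteq> S)"
proof
  assume S: "openin shift_topology S"
  show "\<forall>x\<in>S. \<exists>n. cylinder n x \<subseteq> S"
  proof
    fix x assume "x \<in> S"
    then obtain U where fin: "finite {i. U i \<noteq> UNIV}" and x: "\<And>i. x i \<in> U i"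
      and sub: "Pi\<^sub>E UNIV U \<subseteq> S"
      using S unfolding shift_topology_def openin_product_topology_alt by (auto simp: PiE_iff)
    obtain n where n: "\<And>i. U i \<noteq> UNIV \<Longrightarrow> i < n"
      using finite_nat_bounded[OF fin] by auto
    have "cylinder n x \<subseteq> Pi\<^sub>E UNIV U"
      unfolding cylinder_def by (auto simp: PiE_iff) (metis n UNIV_I x)
    then show "\<exists>n. cylinder n x \<subseteq> S"
      using sub by blast
  qed
next
  assume S: "\<forall>x\<in>S. \<exists>n. cylinder n x \<subseteq> S"
  show "openin shift_topology S"
    unfolding shift_topology_def openin_product_topology_alt
  proof
    fix x assume "x \<in> S"
    then obtain n where n: "cylinder n x \<subseteq> S"
      using S by blast
    let ?U = "\<lambda>i. if i < n then {x i} else UNIV"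
    have "{i. ?U i \<noteq> UNIV} \<subseteq> {..<n}"
      by auto
    then have "finite {i. ?U i \<noteq> UNIV}"
      by (rule finite_subset) simp
    moreover have "Pi\<^sub>E UNIV ?U \<subseteq> S"
    proof -
      have "Pi\<^sub>E UNIV ?U \<subseteq> cylinder n x"
      proof
        fix y assume "y \<in> Pi\<^sub>E UNIV ?U"
        then have "y i \<in> ?U i" for i
          by (rule PiE_mem) simp
        then have "y i = x i" if "i < n" for i
          using that by (metis (full_types) singletonD)
        then show "y \<in> cylinder n x"
          by (simp add: cylinder_def)
      qed
      then show ?thesis using n by blast
    qed
    ultimately show "\<exists>U. finite {i \<in> UNIV. U i \<noteq> topspace (discrete_topology UNIV)} \<and>
        (\<forall>i\<in>UNIV. openin (discrete_topology UNIV) (U i)) \<and> x \<in> Pi\<^sub>E UNIV U \<and> Pi\<^sub>E UNIV U \<subseteq> S"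
      by (intro exI[of _ ?U]) (auto simp: PiE_iff)
  qed
qed

lemma compact_space_shift_topology: "compact_space (shift_topology :: (nat \<Rightarrow> 'a::finite) topology)"
  by (simp add: shift_topology_def compact_space_product_topology compact_space_discrete_topology)

lemma shift_vimage_singleton: "{y. shift y = x} = range (\<lambda>a. case_nat a x)"
  by (auto simp: shift_def image_def fun_eq_iff split: nat.splits)

lemma continuous_map_prepend: "continuous_map shift_topology shift_topology (\<lambda>x. case_nat a x)"
proof -
  have "openin shift_topology {x. case_nat a x \<in> U}" if U: "openin shift_topology U" for U
    unfolding openin_shift_topology_iff
  proof
    fix x assume "x \<in> {x. case_nat a x \<in> U}"
    then obtain n where "cylinder n (case_nat a x) \<subseteq> U"
      using U unfolding openin_shift_topology_iff by blast
    moreover have "case_nat a y \<in> cylinder n (case_nat a x)" if "y \<in> cylinder n x" for y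
      using that by (auto simp: cylinder_def split: nat.splits)
    ultimately show "\<exists>n. cylinder n x \<subseteq> {x. case_nat a x \<in> U}"
      by blast
  qed
  then show ?thesis
    by (simp add: continuous_map_def)
qed

lemma continuous_map_indicator_cylinder:
  "continuous_map shift_topology euclideanreal (indicat_real (cylinder n x))"
proof -
  have "cylinder n y \<subseteq> {z. indicat_real (cylinder n x) z \<in> U}"
    if "indicat_real (cylinder n x) y \<in> U" for y U
  proof
    fix z assume "z \<in> cylinder n y"
    then have "z \<in> cylinder n x \<longleftrightarrow> y \<in> cylinder n x"
      by (simp add: cylinder_def)
    then show "z \<in> {z. indicat_real (cylinder n x) z \<in> U}"
      using that by (simp add: indicator_def)
  qed
  then show ?thesis
    by (auto simp: continuous_map_def openin_shift_topology_iff)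
qed

section \<open>Continuous functions are bounded and measurable\<close>

lemma cylinder_in_sets: "cylinder n x \<in> sets (shift_space :: (nat \<Rightarrow> 'a) measure)"
proof -
  have "{y \<in> space shift_space. \<forall>i<n. y i = x i} \<in> sets (shift_space :: (nat \<Rightarrow> 'a) measure)"
    unfolding shift_space_def by measurable
  then show ?thesis
    by (simp add: cylinder_def)
qed

text \<open>
  Over a finite alphabet there are only countably many cylinders, and an open set is the union of
  those that it contains.
\<close>

lemma openin_shift_topology_imp_sets:
  fixes S :: "(nat \<Rightarrow> 'a::finite) set"
  assumes "openin shift_topology S"
  shows "S \<in> sets shift_space"
proof -
  let ?C = "{c. (\<exists>n x. c = cylinder n x) \<and> c \<subseteq> S}"
  have "cylinder n x \<in> range (\<lambda>w. {y. \<forall>i<length w. y i = w ! i})" for n and x :: "nat \<Rightarrow> 'a"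
    by (rule image_eqI[of _ _ "map x [0..<n]"]) (auto simp: cylinder_def)
  then have "?C \<subseteq> range (\<lambda>w. {y. \<forall>i<length w. y i = w ! i})"
    by blast
  then have "countable ?C"
    by (rule countable_subset) simp
  then have "\<Union> ?C \<in> sets shift_space"
    by (rule sets.countable_Union) (auto simp: cylinder_in_sets)
  moreover have "\<Union> ?C = S"
  proof
    show "S \<subseteq> \<Union> ?C"
    proof
      fix x assume "x \<in> S"
      then obtain n where "cylinder n x \<subseteq> S"
        using assms unfolding openin_shift_topology_iff by blast
      moreover have "x \<in> cylinder n x"
        by (simp add: cylinder_def)
      ultimately show "x \<in> \<Union> ?C"
        by blast
    qed
  qed blast
  ultimately show ?thesis
    by simp
qed

lemma continuous_map_imp_borel_measurable:
  fixes f :: "(nat \<Rightarrow> 'a::finite) \<Rightarrow> real"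
  assumes "continuous_map shift_topology euclideanreal f"
  shows "f \<in> borel_measurable shift_space"
proof (rule borel_measurableI)
  fix U :: "real set" assume "open U"
  then have "openin shift_topology {x. f x \<in> U}"
    using assms by (simp add: continuous_map_def)
  then show "f -` U \<inter> space shift_space \<in> sets shift_space"
    using openin_shift_topology_imp_sets by (simp add: vimage_def)
qed

lemma compact_range_continuous_map:
  fixes f :: "(nat \<Rightarrow> 'a::finite) \<Rightarrow> real"
  assumes "continuous_map shift_topology euclideanreal f"
  shows "compact (range f)"
  using image_compactin[OF _ assms, of UNIV] compact_space_shift_topology
  by (simp add: compact_space_def)

lemma continuous_map_bounded:
  fixes f :: "(nat \<Rightarrow> 'a::finite) \<Rightarrow> real"
  assumes "continuous_map shift_topology euclideanreal f"
  obtains K where "0 < K" "\<And>x. \<bar>f x\<bar> \<le> K"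
  using compact_imp_bounded[OF compact_range_continuous_map[OF assms]]
  unfolding bounded_pos by auto

lemma integrable_continuous_map:
  fixes f :: "(nat \<Rightarrow> 'a::finite) \<Rightarrow> real"
  assumes "prob_space \<mu>" "sets \<mu> = sets shift_space"
    and f: "continuous_map shift_topology euclideanreal f"
  shows "integrable \<mu> f"
proof -
  interpret prob_space \<mu> by fact
  obtain K where "\<And>x. \<bar>f x\<bar> \<le> K"
    using continuous_map_bounded[OF f] by metis
  moreover have "f \<in> borel_measurable \<mu>"
    using continuous_map_imp_borel_measurable[OF f] measurable_cong_sets[OF assms(2) refl] by blast
  ultimately show ?thesis
    by (intro integrable_const_bound[where B = K]) auto
qed

lemma continuous_map_real_ln:
  fixes f :: "'b \<Rightarrow> real"
  assumes "continuous_map X euclideanreal f" "\<And>x. 0 < f x"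
  shows "continuous_map X euclideanreal (\<lambda>x. ln (f x))"
proof -
  have "f x \<noteq> 0" for x
    using assms(2)[of x] by simp
  then show ?thesis
    using assms(1) by (simp add: continuous_map_atin tendsto_ln)
qed

section \<open>Hoelder functions and Jacobians\<close>

lemma shift_dist_le_of_mem_cylinder:
  assumes "y \<in> cylinder n x"
  shows "shift_dist y x \<le> (1 / 2) ^ n"
proof (cases "y = x")
  case False
  define k where "k = (LEAST i. y i \<noteq> x i)"
  have "\<exists>i. y i \<noteq> x i"
    using False by auto
  then have "y k \<noteq> x k"
    unfolding k_def by (rule LeastI_ex)
  then have "n \<le> k"
    using assms unfolding cylinder_def by (intro leI) blast
  then have "(1 / 2) ^ k \<le> ((1 / 2) ^ n :: real)"
    by (rule power_decreasing) auto
  then show ?thesis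
    using False by (simp only: shift_dist_def k_def if_False)
qed (simp add: shift_dist_def)

lemma shift_dist_nonneg: "0 \<le> shift_dist x y"
  by (simp add: shift_dist_def)

lemma shift_dist_le_1: "shift_dist x y \<le> 1"
  by (simp add: shift_dist_def power_le_one)

lemma holder_imp_continuous_map:
  assumes "holder f"
  shows "continuous_map shift_topology euclideanreal f"
proof -
  obtain C \<alpha> where \<alpha>: "0 < \<alpha>" and f: "\<And>x y. \<bar>f x - f y\<bar> \<le> C * shift_dist x y powr \<alpha>"
    using assms unfolding holder_def by blast
  have "\<exists>n. cylinder n x \<subseteq> {y. f y \<in> U}" if U: "open U" "f x \<in> U" for x U
  proof -
    obtain e where e: "0 < e" "\<And>t. \<bar>t - f x\<bar> < e \<Longrightarrow> t \<in> U"
      using U unfolding open_dist dist_real_def by metis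
    have "(\<lambda>n. ((1 / 2) ^ n :: real)) \<longlonglongrightarrow> 0"
      by (rule LIMSEQ_power_zero) simp
    then have "(\<lambda>n. ((1 / 2) ^ n :: real) powr \<alpha>) \<longlonglongrightarrow> 0 powr \<alpha>"
      using \<alpha> by (intro tendsto_powr') auto
    then have "(\<lambda>n. \<bar>C\<bar> * ((1 / 2) ^ n :: real) powr \<alpha>) \<longlonglongrightarrow> \<bar>C\<bar> * 0"
      by (intro tendsto_mult_left) simp
    then have "\<forall>\<^sub>F n in sequentially. \<bar>C\<bar> * ((1 / 2) ^ n :: real) powr \<alpha> < e"
      using e by (intro order_tendstoD) auto
    then obtain n where n: "\<bar>C\<bar> * ((1 / 2) ^ n :: real) powr \<alpha> < e"
      by (auto simp: eventually_sequentially)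
    have "f y \<in> U" if "y \<in> cylinder n x" for y
    proof -
      have "\<bar>f y - f x\<bar> \<le> \<bar>C\<bar> * shift_dist y x powr \<alpha>"
        by (rule order_trans[OF f]) (intro mult_right_mono, auto)
      also have "\<dots> \<le> \<bar>C\<bar> * ((1 / 2) ^ n) powr \<alpha>"
        using shift_dist_le_of_mem_cylinder[OF that] \<alpha>
        by (intro mult_left_mono powr_mono2) (auto simp: shift_dist_nonneg)
      finally show ?thesis
        using n e by force
    qed
    then show ?thesis
      by blast
  qed
  then show ?thesis
    by (auto simp: continuous_map_def openin_shift_topology_iff)
qed

text \<open>
  Distances are at most \<open>1\<close>, so both functions are Hoelder with the smaller of their two exponents.
\<close>

lemma holder_linear_combination:
  assumes "holder f" "holder g"
  shows "holder (\<lambda>x. a * f x + b * g x)"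
proof -
  obtain C \<alpha> where \<alpha>: "0 < \<alpha>" "\<alpha> \<le> 1" and f: "\<And>x y. \<bar>f x - f y\<bar> \<le> C * shift_dist x y powr \<alpha>"
    using assms(1) unfolding holder_def by blast
  obtain D \<beta> where \<beta>: "0 < \<beta>" "\<beta> \<le> 1" and g: "\<And>x y. \<bar>g x - g y\<bar> \<le> D * shift_dist x y powr \<beta>"
    using assms(2) unfolding holder_def by blast
  define \<gamma> where "\<gamma> = min \<alpha> \<beta>"
  have le: "E * shift_dist x y powr \<delta> \<le> \<bar>E\<bar> * shift_dist x y powr \<gamma>" if "\<gamma> \<le> \<delta>" for E \<delta> x y
    using that
    by (intro mult_mono powr_mono') (auto simp: shift_dist_nonneg shift_dist_le_1)
  have "\<bar>(a * f x + b * g x) - (a * f y + b * g y)\<bar>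
      \<le> (\<bar>a\<bar> * \<bar>C\<bar> + \<bar>b\<bar> * \<bar>D\<bar>) * shift_dist x y powr \<gamma>" for x y
  proof -
    have "\<bar>(a * f x + b * g x) - (a * f y + b * g y)\<bar> = \<bar>a * (f x - f y) + b * (g x - g y)\<bar>"
      by (simp add: algebra_simps)
    also have "\<dots> \<le> \<bar>a\<bar> * \<bar>f x - f y\<bar> + \<bar>b\<bar> * \<bar>g x - g y\<bar>"
      by (rule order_trans[OF abs_triangle_ineq]) (simp add: abs_mult)
    also have "\<dots> \<le> \<bar>a\<bar> * (\<bar>C\<bar> * shift_dist x y powr \<gamma>) + \<bar>b\<bar> * (\<bar>D\<bar> * shift_dist x y powr \<gamma>)"
      using le[of \<alpha> C x y] le[of \<beta> D x y] f[of x y] g[of x y]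
      by (intro add_mono mult_left_mono) (auto simp: \<gamma>_def)
    finally show ?thesis
      by (simp add: algebra_simps)
  qed
  then show ?thesis
    using \<alpha> \<beta> unfolding holder_def
    by (intro exI[of _ "\<bar>a\<bar> * \<bar>C\<bar> + \<bar>b\<bar> * \<bar>D\<bar>"] exI[of _ \<gamma>]) (auto simp: \<gamma>_def)
qed

lemma ruelle_ln_eq_sum:
  assumes "\<And>x. 0 < J x"
  shows "ruelle (\<lambda>y. ln (J y)) f x = (\<Sum>a\<in>UNIV. J (case_nat a x) * f (case_nat a x))"
proof -
  have "inj (\<lambda>a. case_nat a x)"
    by (rule injI) (metis old.nat.simps(4))
  then show ?thesis
    unfolding ruelle_def shift_vimage_singleton by (simp add: sum.reindex assms)
qed

lemma holder_jacobian_pos: "holder_jacobian J \<Longrightarrow> 0 < J x"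
  by (simp add: holder_jacobian_def)

lemma holder_jacobian_continuous:
  "holder_jacobian J \<Longrightarrow> continuous_map shift_topology euclideanreal J"
  by (simp add: holder_jacobian_def holder_imp_continuous_map)

lemma holder_jacobian_iff:
  "holder_jacobian J \<longleftrightarrow> (\<forall>x. 0 < J x \<and> J x < 1) \<and> holder J \<and>
     (\<forall>x. (\<Sum>a\<in>UNIV. J (case_nat a x)) = 1)"
  by (auto simp: holder_jacobian_def fun_eq_iff ruelle_ln_eq_sum)

lemma holder_jacobian_convex:
  assumes J: "holder_jacobian J" and J': "holder_jacobian J'" and l: "0 \<le> l" "l \<le> 1"
  shows "holder_jacobian (\<lambda>x. l * J' x + (1 - l) * J x)"
proof -
  have "0 < l * J' x + (1 - l) * J x \<and> l * J' x + (1 - l) * J x < 1" for x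
  proof -
    have "J x \<in> {0<..<1}" "J' x \<in> {0<..<1}"
      using J J' by (auto simp: holder_jacobian_iff)
    then have "l *\<^sub>R J' x + (1 - l) *\<^sub>R J x \<in> {0<..<1}"
      using l by (intro convexD[OF convex_real_interval(8)]) auto
    then show ?thesis
      by simp
  qed
  moreover have "holder (\<lambda>x. l * J' x + (1 - l) * J x)"
    using J J' by (intro holder_linear_combination) (auto simp: holder_jacobian_iff)
  moreover have "(\<Sum>a\<in>UNIV. l * J' (case_nat a x) + (1 - l) * J (case_nat a x)) = 1" for x
    using J J' by (simp add: sum.distrib holder_jacobian_iff flip: sum_distrib_left)
  ultimately show ?thesis
    by (simp add: holder_jacobian_iff)
qed

section \<open>An equilibrium probability determines its Jacobian\<close>

lemma equilibrium_prob_integral_sum: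
  assumes "holder_jacobian J" "equilibrium_prob J \<mu>"
    and "continuous_map shift_topology euclideanreal f"
  shows "(LINT x|\<mu>. (\<Sum>a\<in>UNIV. J (case_nat a x) * f (case_nat a x))) = (LINT x|\<mu>. f x)"
proof -
  have "ruelle (\<lambda>y. ln (J y)) f = (\<lambda>x. \<Sum>a\<in>UNIV. J (case_nat a x) * f (case_nat a x))"
    by (rule ext, rule ruelle_ln_eq_sum, rule holder_jacobian_pos[OF assms(1)])
  moreover have "(LINT x|\<mu>. ruelle (\<lambda>y. ln (J y)) f x) = (LINT x|\<mu>. f x)"
    using assms(2,3) by (simp add: equilibrium_prob_def)
  ultimately show ?thesis
    by simp
qed

text \<open>
  Testing the fixed-point equation on the indicator of the cylinder \<open>a w\<close> expresses its mass as the
  integral of the positive function \<open>J (a x)\<close> over the cylinder \<open>w\<close>; hence positivity propagates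
  from words of length \<open>n\<close> to words of length \<open>n + 1\<close>.
\<close>

lemma equilibrium_prob_cylinder_pos:
  assumes J: "holder_jacobian J" and \<mu>: "equilibrium_prob J \<mu>"
  shows "0 < measure \<mu> (cylinder n y)"
proof (induction n arbitrary: y)
  interpret prob_space \<mu>
    using \<mu> by (simp add: equilibrium_prob_def)
  have sets: "sets \<mu> = sets shift_space"
    using \<mu> by (simp add: equilibrium_prob_def)
  then have space: "space \<mu> = UNIV"
    using sets_eq_imp_space_eq by force
  note int = integrable_continuous_map[OF prob_space_axioms sets]
  {
    case 0
    show ?case
      using prob_space space by (simp add: cylinder_def)
  next
    case (Suc n)
    let ?g = "\<lambda>x. J (case_nat (y 0) x) * indicat_real (cylinder n (shift y)) x"
    have "(\<Sum>a\<in>UNIV. J (case_nat a x) * indicat_real (cylinder (Suc n) y) (case_nat a x)) = ?g x" for x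
    proof -
      have ind: "indicat_real (cylinder (Suc n) y) (case_nat a x)
          = (if a = y 0 then indicat_real (cylinder n (shift y)) x else 0)" for a
        by (auto simp: cylinder_def indicator_def shift_def All_less_Suc2)
      have "J (case_nat a x) * indicat_real (cylinder (Suc n) y) (case_nat a x)
          = (if a = y 0 then ?g x else 0)" for a
        unfolding ind by simp
      then show ?thesis
        by (simp only: sum.delta' sum.delta finite UNIV_I if_True)
    qed
    then have "(LINT x|\<mu>. ?g x) = (LINT x|\<mu>. indicat_real (cylinder (Suc n) y) x)"
      using equilibrium_prob_integral_sum[OF J \<mu> continuous_map_indicator_cylinder[of "Suc n" y]]
      by simp
    then have eq: "(LINT x|\<mu>. ?g x) = measure \<mu> (cylinder (Suc n) y)"
      by (simp add: space)
    have g_int: "integrable \<mu> ?g"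
      using continuous_map_compose[OF continuous_map_prepend holder_jacobian_continuous[OF J]]
      by (intro int continuous_map_real_mult continuous_map_indicator_cylinder) (simp add: o_def)
    have g_nonneg: "0 \<le> ?g x" for x
      using holder_jacobian_pos[OF J] by (simp add: less_imp_le)
    have "(LINT x|\<mu>. ?g x) \<noteq> 0"
    proof
      assume "(LINT x|\<mu>. ?g x) = 0"
      then have "AE x in \<mu>. ?g x = 0"
        using integral_nonneg_eq_0_iff_AE[OF g_int] g_nonneg by simp
      then have "AE x in \<mu>. x \<notin> cylinder n (shift y)"
        using holder_jacobian_pos[OF J]
        by (auto elim!: eventually_mono simp: less_imp_neq[THEN not_sym] indicator_def split: if_splits)
      then have "measure \<mu> (cylinder n (shift y)) = 0"
        using prob_eq_0 cylinder_in_sets sets by metis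
      then show False
        using Suc.IH[of "shift y"] by simp
    qed
    then show ?case
      using eq zero_less_measure_iff by metis
  }
qed

text \<open>
  A continuous function that is positive at a point is positive on a cylinder around it, and that
  cylinder carries mass.
\<close>

lemma equilibrium_prob_integral_zero_imp:
  assumes J: "holder_jacobian J" and \<mu>: "equilibrium_prob J \<mu>"
    and g: "continuous_map shift_topology euclideanreal g" "\<And>x. 0 \<le> g x"
    and zero: "(LINT x|\<mu>. g x) = 0"
  shows "g x = 0"
proof (rule ccontr)
  assume "g x \<noteq> 0"
  then have "g x \<in> {0<..}"
    using g(2)[of x] by simp
  moreover have "openin shift_topology {x. g x \<in> {0<..}}"
    using g(1) open_greaterThan[of "0::real"] unfolding continuous_map_def
    by (simp del: greaterThan_iff)
  ultimately obtain n where n: "cylinder n x \<subseteq> {x. g x \<in> {0<..}}"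
    unfolding openin_shift_topology_iff by blast
  interpret prob_space \<mu>
    using \<mu> by (simp add: equilibrium_prob_def)
  have sets: "sets \<mu> = sets shift_space"
    using \<mu> by (simp add: equilibrium_prob_def)
  have "AE x in \<mu>. g x = 0"
    using integral_nonneg_eq_0_iff_AE[OF integrable_continuous_map[OF prob_space_axioms sets g(1)]]
      g(2) zero by simp
  then have "AE z in \<mu>. z \<notin> cylinder n x"
    using n by (auto elim!: eventually_mono)
  then have "measure \<mu> (cylinder n x) = 0"
    using prob_eq_0 cylinder_in_sets sets by metis
  then show False
    using equilibrium_prob_cylinder_pos[OF J \<mu>, of n x] by simp
qed

lemma equilibrium_prob_jacobian_unique:
  fixes J J' :: "(nat \<Rightarrow> 'a::finite) \<Rightarrow> real"
  assumes J: "holder_jacobian J" and \<mu>: "equilibrium_prob J \<mu>"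
    and J': "holder_jacobian J'" and \<mu>': "equilibrium_prob J' \<mu>"
  shows "J = J'"
proof -
  \<comment> \<open>as a test function \<open>J - J'\<close> turns the difference of the two equations into a sum of squares\<close>
  let ?f = "\<lambda>x. J x - J' x"
  have prob: "prob_space \<mu>" and sets: "sets \<mu> = sets shift_space"
    using \<mu> by (auto simp: equilibrium_prob_def)
  note int = integrable_continuous_map[OF prob sets]
  note cont = holder_jacobian_continuous[OF J] holder_jacobian_continuous[OF J']
  have f: "continuous_map shift_topology euclideanreal ?f"
    by (intro continuous_map_diff cont)
  have prepend: "continuous_map shift_topology euclideanreal (\<lambda>x. F (case_nat a x))"
    if "continuous_map shift_topology euclideanreal F" for F :: "(nat \<Rightarrow> 'a) \<Rightarrow> real" and a
    using continuous_map_compose[OF continuous_map_prepend that] by (simp add: o_def)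
  let ?L = "\<lambda>J x. \<Sum>a\<in>UNIV. J (case_nat a x) * ?f (case_nat a x)"
  have L: "integrable \<mu> (?L J)" "integrable \<mu> (?L J')"
    by (intro int continuous_map_sum continuous_map_real_mult prepend f cont; simp)+
  have "(LINT x|\<mu>. ?L J x) = (LINT x|\<mu>. ?f x)"
    by (rule equilibrium_prob_integral_sum[OF J \<mu> f])
  moreover have "(LINT x|\<mu>. ?L J' x) = (LINT x|\<mu>. ?f x)"
    by (rule equilibrium_prob_integral_sum[OF J' \<mu>' f])
  ultimately have "(LINT x|\<mu>. ?L J x - ?L J' x) = 0"
    using Bochner_Integration.integral_diff[OF L] by simp
  moreover have "?L J x - ?L J' x = (\<Sum>a\<in>UNIV. (?f (case_nat a x))\<^sup>2)" for x
    by (simp add: power2_eq_square left_diff_distrib flip: sum_subtractf)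
  ultimately have zero: "(LINT x|\<mu>. (\<Sum>a\<in>UNIV. (?f (case_nat a x))\<^sup>2)) = 0"
    by simp
  have "continuous_map shift_topology euclideanreal (\<lambda>x. \<Sum>a\<in>UNIV. (?f (case_nat a x))\<^sup>2)"
    by (intro continuous_map_sum continuous_map_real_pow prepend[OF f]) simp
  then have "(\<Sum>a\<in>UNIV. (?f (case_nat a x))\<^sup>2) = 0" for x
    by (rule equilibrium_prob_integral_zero_imp[OF J \<mu> _ _ zero]) (simp add: sum_nonneg)
  then have *: "J (case_nat a x) = J' (case_nat a x)" for a x
    by (simp add: sum_nonneg_eq_0_iff)
  show ?thesis
  proof
    fix x :: "nat \<Rightarrow> 'a"
    have "case_nat (x 0) (shift x) = x"
      by (auto simp: shift_def fun_eq_iff split: nat.splits)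
    then show "J x = J' x"
      using *[of "x 0" "shift x"] by simp
  qed
qed

lemma jacobian_of_eq:
  assumes "holder_jacobian J" "equilibrium_prob J \<mu>"
  shows "jacobian_of \<mu> = J"
  unfolding jacobian_of_def using assms equilibrium_prob_jacobian_unique by blast

section \<open>The derivative of the divergence\<close>

text \<open>
  Differentiation at \<open>0\<close> under the integral sign for \<open>ln (1 + l h)\<close> with \<open>h\<close> bounded by \<open>K\<close>: the error of the
  linear approximation is at most \<open>2 K\<^sup>2 l\<^sup>2\<close> as soon as \<open>\<bar>l\<bar> K \<le> 1/2\<close>.
\<close>

lemma (in prob_space) has_real_derivative_integral_ln_one_plus:
  fixes h :: "'a \<Rightarrow> real"
  assumes h: "integrable M h" and K: "0 < K" "\<And>x. \<bar>h x\<bar> \<le> K"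
    and F: "\<And>l. l \<in> S \<Longrightarrow> integrable M (\<lambda>x. ln (1 + l * h x))"
  shows "((\<lambda>l. LINT x|M. ln (1 + l * h x)) has_real_derivative (LINT x|M. h x)) (at 0 within S)"
proof -
  let ?F = "\<lambda>l. LINT x|M. ln (1 + l * h x)" and ?c = "LINT x|M. h x"
  have bound: "\<bar>?F l / l - ?c\<bar> \<le> 2 * K\<^sup>2 * \<bar>l\<bar>" if l: "l \<in> S" "\<bar>l\<bar> < 1 / (2 * K)" "l \<noteq> 0" for l
  proof -
    have "\<bar>l * h x\<bar> \<le> \<bar>l\<bar> * K" for x
      by (simp add: abs_mult K mult_left_mono)
    moreover have "\<bar>l\<bar> * K \<le> 1 / 2"
      using l K by (simp add: field_simps)
    ultimately have half: "\<bar>l * h x\<bar> \<le> 1 / 2" for x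
      by (meson order_trans)
    have pt: "\<bar>ln (1 + l * h x) - l * h x\<bar> \<le> 2 * (\<bar>l\<bar> * K)\<^sup>2" for x
    proof -
      have "(l * h x)\<^sup>2 \<le> (\<bar>l\<bar> * K)\<^sup>2"
        using \<open>\<bar>l * h x\<bar> \<le> \<bar>l\<bar> * K\<close> by (metis abs_ge_zero power2_abs power_mono)
      then show ?thesis
        using abs_ln_one_plus_x_minus_x_bound[OF half[of x]] by simp
    qed
    have "\<bar>?F l - l * ?c\<bar> = \<bar>LINT x|M. ln (1 + l * h x) - l * h x\<bar>"
      using F[OF l(1)] h by simp
    also have "\<dots> \<le> (LINT x|M. \<bar>ln (1 + l * h x) - l * h x\<bar>)"
      by (rule integral_abs_bound)
    also have "\<dots> \<le> (LINT x|M. 2 * (\<bar>l\<bar> * K)\<^sup>2)"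
      using F[OF l(1)] h pt by (intro integral_mono) auto
    also have "\<dots> = \<bar>l\<bar> * (2 * K\<^sup>2 * \<bar>l\<bar>)"
      by (simp add: prob_space power2_eq_square)
    finally have "\<bar>l\<bar> * \<bar>?F l / l - ?c\<bar> \<le> \<bar>l\<bar> * (2 * K\<^sup>2 * \<bar>l\<bar>)"
      using l(3) by (simp add: right_diff_distrib flip: abs_mult)
    then show ?thesis
      using l(3) by simp
  qed
  have "\<forall>\<^sub>F l in at 0 within S. l \<in> S \<and> \<bar>l\<bar> < 1 / (2 * K) \<and> l \<noteq> 0"
    unfolding eventually_at using K by (intro exI[of _ "1 / (2 * K)"]) (auto simp: dist_real_def)
  then have "\<forall>\<^sub>F l in at 0 within S. norm (?F l / l - ?c) \<le> 2 * K\<^sup>2 * \<bar>l\<bar>"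
    by (rule eventually_mono) (use bound in auto)
  moreover have "((\<lambda>l. 2 * K\<^sup>2 * \<bar>l\<bar>) \<longlongrightarrow> 0) (at 0 within S)"
    by (rule tendsto_eq_intros refl | simp)+
  ultimately have "((\<lambda>l. ?F l / l - ?c) \<longlongrightarrow> 0) (at 0 within S)"
    by (rule Lim_null_comparison)
  then show ?thesis
    unfolding has_field_derivative_iff by (subst LIM_zero_iff[symmetric]) simp
qed

theorem proposition1p3:
  fixes J0 J1' J1 :: "(nat \<Rightarrow> 'a::finite) \<Rightarrow> real"
    and \<mu>1 :: "(nat \<Rightarrow> 'a) measure"
    and JJ :: "real \<Rightarrow> (nat \<Rightarrow> 'a) \<Rightarrow> real"
    and \<mu> :: "real \<Rightarrow> (nat \<Rightarrow> 'a) measure"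
  assumes "holder_jacobian J0" and "holder_jacobian J1'" and "J1' \<noteq> J0"
    and "holder_jacobian J1" and "equilibrium_prob J1 \<mu>1"
    and "\<And>l x. l \<in> {0..1} \<Longrightarrow> JJ l x = l * J1' x + (1 - l) * J0 x"
    and "\<And>l. l \<in> {0..1} \<Longrightarrow> equilibrium_prob (JJ l) (\<mu> l)"
  shows "((\<lambda>l. D_KL \<mu>1 (\<mu> l)) has_real_derivative (LINT x|\<mu>1. 1 - J1' x / J0 x))
           (at 0 within {0..1})"
proof -
  interpret prob_space \<mu>1
    using assms(5) by (simp add: equilibrium_prob_def)
  have sets: "sets \<mu>1 = sets shift_space"
    using assms(5) by (simp add: equilibrium_prob_def)
  note int = integrable_continuous_map[OF prob_space_axioms sets]
  note pos = holder_jacobian_pos[OF assms(1)] holder_jacobian_pos[OF assms(2)]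
    holder_jacobian_pos[OF assms(4)]
  note cont = holder_jacobian_continuous[OF assms(1)] holder_jacobian_continuous[OF assms(2)]
    holder_jacobian_continuous[OF assms(4)]
  define h where "h x = J1' x / J0 x - 1" for x
  have h: "continuous_map shift_topology euclideanreal h"
    unfolding h_def using pos(1)
    by (intro continuous_map_diff continuous_map_real_divide cont) (auto simp: less_imp_neq[THEN not_sym])
  obtain K where K: "0 < K" "\<And>x. \<bar>h x\<bar> \<le> K"
    using continuous_map_bounded[OF h] by metis
  have JJ: "holder_jacobian (JJ l)" "JJ l = (\<lambda>x. J0 x * (1 + l * h x))" if "l \<in> {0..1}" for l
  proof -
    have eq: "JJ l = (\<lambda>x. l * J1' x + (1 - l) * J0 x)"
      using assms(6)[OF that] by blast
    show "holder_jacobian (JJ l)"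
      unfolding eq using that assms(1,2) by (intro holder_jacobian_convex) auto
    have "J0 x \<noteq> 0" for x
      using pos(1)[of x] by simp
    then show "JJ l = (\<lambda>x. J0 x * (1 + l * h x))"
      unfolding eq h_def by (auto simp: field_simps)
  qed
  have factor_pos: "0 < 1 + l * h x" if "l \<in> {0..1}" for l x
    using holder_jacobian_pos[OF JJ(1)[OF that], of x] pos(1)[of x]
    by (simp add: JJ(2)[OF that] zero_less_mult_iff)
  have ln_int: "integrable \<mu>1 (\<lambda>x. ln (1 + l * h x))" if "l \<in> {0..1}" for l
    using factor_pos[OF that]
    by (intro int continuous_map_real_ln continuous_map_add continuous_map_real_mult h) auto
  let ?D = "LINT x|\<mu>1. ln (J1 x) - ln (J0 x)"
  have D: "D_KL \<mu>1 (\<mu> l) = ?D - (LINT x|\<mu>1. ln (1 + l * h x))" if l: "l \<in> {0..1}" for l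
  proof -
    have "D_KL \<mu>1 (\<mu> l) = (LINT x|\<mu>1. ln (J1 x) - ln (JJ l x))"
      unfolding D_KL_def
      using jacobian_of_eq[OF assms(4,5)] jacobian_of_eq[OF JJ(1)[OF l] assms(7)[OF l]] by simp
    also have "\<dots> = (LINT x|\<mu>1. (ln (J1 x) - ln (J0 x)) - ln (1 + l * h x))"
      unfolding JJ(2)[OF l] ln_mult_pos[OF pos(1) factor_pos[OF l]] by (simp only: diff_diff_eq)
    also have "\<dots> = ?D - (LINT x|\<mu>1. ln (1 + l * h x))"
      by (intro Bochner_Integration.integral_diff ln_int[OF l] int continuous_map_diff
          continuous_map_real_ln cont pos)
    finally show ?thesis .
  qed
  have "((\<lambda>l. ?D - (LINT x|\<mu>1. ln (1 + l * h x))) has_real_derivative 0 - (LINT x|\<mu>1. h x))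
      (at 0 within {0..1})"
    using has_real_derivative_integral_ln_one_plus[OF int[OF h] K ln_int]
    by (intro DERIV_diff DERIV_const)
  moreover have "0 - (LINT x|\<mu>1. h x) = (LINT x|\<mu>1. 1 - J1' x / J0 x)"
    by (simp add: h_def flip: Bochner_Integration.integral_minus)
  ultimately show ?thesis
    using D by (subst has_field_derivative_cong_eventually
        [where g = "\<lambda>l. ?D - (LINT x|\<mu>1. ln (1 + l * h x))"])
      (auto simp: eventually_at_filter)
qed

end
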